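(* For every integer $n\ge0$, the misère monoid $\mathcal{M}_{\mathrm{cl}(\mathsf{L}(\tau^{2n+1}))}$ has exactly four elements, namely the equivalence classes of $0$, $*$, $*+*$ and $\mathsf{L}(\tau^{2n+1})$.
   Context: A position $\xi=\{\xi^L \mid \xi^R\}$ is given recursively by finite sets of Left and Right options; $\cdot$ denotes an empty set. $0=\{\cdot\mid\cdot\}$, $*=\{0\mid0\}$, $\tau^0=*$, $\tau^k=\{\tau^{k-1}\mid\tau^{k-1}\}$ for $k\ge1$, and $\mathsf{L}(\xi)=\{\xi\mid\cdot\}$. Disjunctive sum: $\alpha+\beta=\{\alpha^L+\beta,\alpha+\beta^L \mid \alpha^R+\beta,\alpha+\beta^R\}$. Under misère play a player unable to move on their turn wins; $o^-$ denotes misère outcome ($\mathcal{L}$, $\mathcal{R}$, $\mathcal{N}$ next player wins, $\mathcal{P}$ next player loses). $\mathrm{cl}(\xi)$ is the smallest set containing $\xi$ closed under disjunctive sum and taking options. For closed $\Gamma$, $\alpha\equiv\beta\pmod\Gamma$ iff $o^-(\alpha+\gamma)=o^-(\beta+\gamma)$ for all $\gamma\in\Gamma$; the misère monoid $\mathcal{M}_\Gamma$ is the set of $\equiv$-classes with the monoid operation induced by disjunctive sum. *)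

theory Defs
  imports "HOL-Library.FSet" "HOL-Algebra.Group"
begin

datatype game = Game (left_opts: "game fset") (right_opts: "game fset")

lemma size_left_opt [termination_simp]: "x |\<in>| A \<Longrightarrow> size x < size (Game A B)"
  using member_le_sum[of x "fset A" "\<lambda>x. Suc (size x)"] by simp

lemma size_right_opt [termination_simp]: "x |\<in>| B \<Longrightarrow> size x < size (Game A B)"
  using member_le_sum[of x "fset B" "\<lambda>x. Suc (size x)"] by simp

lemma fimage_fundef_cong [fundef_cong]:
  "A = B \<Longrightarrow> (\<And>x. x |\<in>| B \<Longrightarrow> f x = g x) \<Longrightarrow> f |`| A = g |`| B"
  by (rule fset.map_cong)

instantiation game :: comm_monoid_add
begin

definition zero_game :: game where
  "0 = Game {||} {||}"

function plus_game :: "game \<Rightarrow> game \<Rightarrow> game" where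
  "plus_game (Game A B) (Game C D) =
     Game ((\<lambda>x. plus_game x (Game C D)) |`| A |\<union>| (\<lambda>y. plus_game (Game A B) y) |`| C)
          ((\<lambda>x. plus_game x (Game C D)) |`| B |\<union>| (\<lambda>y. plus_game (Game A B) y) |`| D)"
  by pat_completeness auto
termination
  by (relation "measure (\<lambda>(x, y). size x + size y)")
     (auto simp del: game.size dest: size_left_opt size_right_opt)

instance
proof
  fix a b c :: game
  show "a + b + c = a + (b + c)"
  proof (induction "size a + size b + size c" arbitrary: a b c rule: less_induct)
    case less
    obtain A A' B B' C C' where g: "a = Game A A'" "b = Game B B'" "c = Game C C'"
      by (meson game.exhaust)
    have 1: "x + b + c = x + (b + c)" if "x |\<in>| A \<or> x |\<in>| A'" for x
      using less[of x b c] that size_left_opt[of x A A'] size_right_opt[of x A' A]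
      unfolding g(1) by linarith
    have 2: "a + x + c = a + (x + c)" if "x |\<in>| B \<or> x |\<in>| B'" for x
      using less[of a x c] that size_left_opt[of x B B'] size_right_opt[of x B' B]
      unfolding g(2) by linarith
    have 3: "a + b + x = a + (b + x)" if "x |\<in>| C \<or> x |\<in>| C'" for x
      using less[of a b x] that size_left_opt[of x C C'] size_right_opt[of x C' C]
      unfolding g(3) by linarith
    show ?case
      using 1 2 3 unfolding g
      by (simp add: fimage_funion fimage_fimage funion_assoc cong: fimage_fundef_cong)
  qed
next
  fix a b :: game
  show "a + b = b + a"
  proof (induction "size a + size b" arbitrary: a b rule: less_induct)
    case less
    obtain A A' B B' where g: "a = Game A A'" "b = Game B B'"
      by (meson game.exhaust)
    have 1: "x + b = b + x" if "x |\<in>| A \<or> x |\<in>| A'" for x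
      using less[of x b] that size_left_opt[of x A A'] size_right_opt[of x A' A]
      unfolding g(1) by linarith
    have 2: "a + x = x + a" if "x |\<in>| B \<or> x |\<in>| B'" for x
      using less[of a x] that size_left_opt[of x B B'] size_right_opt[of x B' B]
      unfolding g(2) by linarith
    show ?case
      using 1 2 unfolding g
      by (simp add: funion_commute cong: fimage_fundef_cong)
  qed
next
  fix a :: game
  show "0 + a = a"
  proof (induction a)
    case (Game A B)
    then show ?case
      by (simp add: zero_game_def cong: fimage_fundef_cong)
  qed
qed

end

definition star :: game where
  "star = Game {|0|} {|0|}"

fun tau :: "nat \<Rightarrow> game" where
  "tau 0 = star"
| "tau (Suc k) = Game {|tau k|} {|tau k|}"

definition LL :: "game \<Rightarrow> game" where
  "LL \<xi> = Game {|\<xi>|} {||}"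

text \<open>\<open>left_wins_first \<xi>\<close> and \<open>right_wins_first \<xi>\<close>: the named player, moving first, wins
  under misere play; a player with no move on their turn wins.\<close>

function left_wins_first :: "game \<Rightarrow> bool" and right_wins_first :: "game \<Rightarrow> bool" where
  "left_wins_first (Game A B) \<longleftrightarrow> A = {||} \<or> fBex A (\<lambda>x. \<not> right_wins_first x)"
| "right_wins_first (Game A B) \<longleftrightarrow> B = {||} \<or> fBex B (\<lambda>x. \<not> left_wins_first x)"
  by pat_completeness auto
termination
  by (relation "measure (\<lambda>s. case s of Inl x \<Rightarrow> size x | Inr x \<Rightarrow> size x)")
     (auto simp del: game.size dest: size_left_opt size_right_opt)

datatype outcome = Outcome_L | Outcome_R | Outcome_N | Outcome_P

definition misere_outcome :: "game \<Rightarrow> outcome" where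
  "misere_outcome \<xi> =
     (if left_wins_first \<xi>
      then (if right_wins_first \<xi> then Outcome_N else Outcome_L)
      else (if right_wins_first \<xi> then Outcome_R else Outcome_P))"

definition closed_games :: "game set \<Rightarrow> bool" where
  "closed_games \<Gamma> \<longleftrightarrow>
     (\<forall>\<alpha>\<in>\<Gamma>. \<forall>\<beta>\<in>\<Gamma>. \<alpha> + \<beta> \<in> \<Gamma>) \<and>
     (\<forall>\<alpha>\<in>\<Gamma>. fset (left_opts \<alpha>) \<subseteq> \<Gamma> \<and> fset (right_opts \<alpha>) \<subseteq> \<Gamma>)"

definition cl :: "game \<Rightarrow> game set" where
  "cl \<xi> = \<Inter>{\<Gamma>. \<xi> \<in> \<Gamma> \<and> closed_games \<Gamma>}"

definition equiv_mod :: "game set \<Rightarrow> game \<Rightarrow> game \<Rightarrow> bool" where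
  "equiv_mod \<Gamma> \<alpha> \<beta> \<longleftrightarrow> (\<forall>\<gamma>\<in>\<Gamma>. misere_outcome (\<alpha> + \<gamma>) = misere_outcome (\<beta> + \<gamma>))"

definition misere_class :: "game set \<Rightarrow> game \<Rightarrow> game set" where
  "misere_class \<Gamma> \<alpha> = {\<beta> \<in> \<Gamma>. equiv_mod \<Gamma> \<alpha> \<beta>}"

text \<open>The multiplication is a union over representatives; for closed \<open>\<Gamma>\<close> all of them give
  the same class, see \<open>misere_monoid_mult\<close> below.\<close>

definition misere_monoid :: "game set \<Rightarrow> game set monoid" where
  "misere_monoid \<Gamma> =
     \<lparr>carrier = misere_class \<Gamma> ` \<Gamma>,
      mult = (\<lambda>X Y. \<Union>\<alpha>\<in>X. \<Union>\<beta>\<in>Y. misere_class \<Gamma> (\<alpha> + \<beta>)),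
      one = misere_class \<Gamma> 0\<rparr>"

lemma cl_self: "\<xi> \<in> cl \<xi>"
  by (auto simp: cl_def)

lemma closed_games_cl: "closed_games (cl \<xi>)"
  unfolding closed_games_def cl_def by blast

lemma cl_least: "\<xi> \<in> \<Gamma> \<Longrightarrow> closed_games \<Gamma> \<Longrightarrow> cl \<xi> \<subseteq> \<Gamma>"
  by (auto simp: cl_def)

lemma zero_in_closed:
  assumes "closed_games \<Gamma>" "\<alpha> \<in> \<Gamma>"
  shows "0 \<in> \<Gamma>"
  using assms(2)
proof (induction \<alpha>)
  case (Game A B)
  show ?case
  proof (cases "A = {||} \<and> B = {||}")
    case True
    then show ?thesis using Game.prems by (simp add: zero_game_def)
  next
    case False
    then obtain x where "x |\<in>| A \<or> x |\<in>| B" by blast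
    moreover have "fset A \<subseteq> \<Gamma>" "fset B \<subseteq> \<Gamma>"
      using assms(1) Game.prems unfolding closed_games_def by force+
    ultimately show ?thesis using Game.IH by blast
  qed
qed

lemma misere_class_eq_iff:
  assumes "\<alpha> \<in> \<Gamma>" "\<beta> \<in> \<Gamma>"
  shows "misere_class \<Gamma> \<alpha> = misere_class \<Gamma> \<beta> \<longleftrightarrow> equiv_mod \<Gamma> \<alpha> \<beta>"
  using assms unfolding misere_class_def equiv_mod_def by fastforce

lemma equiv_mod_add:
  assumes "closed_games \<Gamma>" "\<alpha> \<in> \<Gamma>" "\<beta>' \<in> \<Gamma>"
    and "equiv_mod \<Gamma> \<alpha> \<alpha>'" "equiv_mod \<Gamma> \<beta> \<beta>'"
  shows "equiv_mod \<Gamma> (\<alpha> + \<beta>) (\<alpha>' + \<beta>')"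
  unfolding equiv_mod_def
proof
  fix \<gamma> assume \<gamma>: "\<gamma> \<in> \<Gamma>"
  have "misere_outcome (\<alpha> + \<beta> + \<gamma>) = misere_outcome (\<beta> + (\<alpha> + \<gamma>))"
    by (simp add: ac_simps)
  also have "\<dots> = misere_outcome (\<beta>' + (\<alpha> + \<gamma>))"
    using assms \<gamma> by (simp add: equiv_mod_def closed_games_def)
  also have "\<dots> = misere_outcome (\<alpha> + (\<beta>' + \<gamma>))"
    by (simp add: ac_simps)
  also have "\<dots> = misere_outcome (\<alpha>' + (\<beta>' + \<gamma>))"
    using assms \<gamma> by (simp add: equiv_mod_def closed_games_def)
  finally show "misere_outcome (\<alpha> + \<beta> + \<gamma>) = misere_outcome (\<alpha>' + \<beta>' + \<gamma>)"
    by (simp add: ac_simps)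
qed

lemma misere_monoid_mult:
  assumes "closed_games \<Gamma>" "\<alpha> \<in> \<Gamma>" "\<beta> \<in> \<Gamma>"
  shows "misere_class \<Gamma> \<alpha> \<otimes>\<^bsub>misere_monoid \<Gamma>\<^esub> misere_class \<Gamma> \<beta> = misere_class \<Gamma> (\<alpha> + \<beta>)"
proof -
  have eq: "misere_class \<Gamma> (x + y) = misere_class \<Gamma> (\<alpha> + \<beta>)"
    if "x \<in> misere_class \<Gamma> \<alpha>" "y \<in> misere_class \<Gamma> \<beta>" for x y
  proof -
    have xy: "x \<in> \<Gamma>" "y \<in> \<Gamma>" "equiv_mod \<Gamma> \<alpha> x" "equiv_mod \<Gamma> \<beta> y"
      using that by (auto simp: misere_class_def)
    then have "equiv_mod \<Gamma> (\<alpha> + \<beta>) (x + y)"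
      using assms by (intro equiv_mod_add) auto
    moreover have "\<alpha> + \<beta> \<in> \<Gamma>" "x + y \<in> \<Gamma>"
      using assms xy unfolding closed_games_def by auto
    ultimately show ?thesis using misere_class_eq_iff by blast
  qed
  have mem: "\<alpha> \<in> misere_class \<Gamma> \<alpha>" "\<beta> \<in> misere_class \<Gamma> \<beta>"
    using assms by (auto simp: misere_class_def equiv_mod_def)
  have "(\<Union>x\<in>misere_class \<Gamma> \<alpha>. \<Union>y\<in>misere_class \<Gamma> \<beta>. misere_class \<Gamma> (x + y))
      = misere_class \<Gamma> (\<alpha> + \<beta>)"
    using eq mem by blast
  then show ?thesis by (simp add: misere_monoid_def)
qed

lemma misere_monoid_comm_monoid:
  assumes "closed_games \<Gamma>" "\<Gamma> \<noteq> {}"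
  shows "comm_monoid (misere_monoid \<Gamma>)"
proof -
  have z: "0 \<in> \<Gamma>" using assms zero_in_closed by blast
  have s: "\<alpha> + \<beta> \<in> \<Gamma>" if "\<alpha> \<in> \<Gamma>" "\<beta> \<in> \<Gamma>" for \<alpha> \<beta>
    using that assms(1) by (auto simp: closed_games_def)
  have c: "carrier (misere_monoid \<Gamma>) = misere_class \<Gamma> ` \<Gamma>"
    and o: "\<one>\<^bsub>misere_monoid \<Gamma>\<^esub> = misere_class \<Gamma> 0"
    by (simp_all add: misere_monoid_def)
  show ?thesis
    by (rule comm_monoidI)
       (auto simp: c o z s misere_monoid_mult[OF assms(1)] ac_simps)
qed

end

theory Submission
  imports Defs
begin

text \<open>In every position of the closure all plays have lengths of the same parity, since the path
  inside the generator has even length. Where the length is even, the player to move wins: Left,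
  if she can move at all, can avoid leaving an odd position in which Right cannot move. Where it
  is odd, the player to move loses, except that Right wins at once if he has no move. Hence the
  outcome depends only on the parity and on whether Right can move. Both data of a sum are
  determined by those of its summands, so they determine the class; conversely the outcomes of
  \<open>g\<close> and of \<open>g + L\<close>, for the generator \<open>L\<close>, recover both data of \<open>g\<close>.\<close>

section \<open>Options, ends and outcomes\<close>

definition options :: "game \<Rightarrow> game fset" where
  "options g = left_opts g |\<union>| right_opts g"

definition left_end :: "game \<Rightarrow> bool" where
  "left_end g \<longleftrightarrow> left_opts g = {||}"

definition right_end :: "game \<Rightarrow> bool" where
  "right_end g \<longleftrightarrow> right_opts g = {||}"

lemma left_opts_plus:
  "left_opts (g + h) = (\<lambda>x. x + h) |`| left_opts g |\<union>| (\<lambda>y. g + y) |`| left_opts h"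
  by (cases g; cases h) simp

lemma right_opts_plus:
  "right_opts (g + h) = (\<lambda>x. x + h) |`| right_opts g |\<union>| (\<lambda>y. g + y) |`| right_opts h"
  by (cases g; cases h) simp

lemma options_plus:
  "options (g + h) = (\<lambda>x. x + h) |`| options g |\<union>| (\<lambda>y. g + y) |`| options h"
  by (auto simp: options_def left_opts_plus right_opts_plus)

lemma left_end_plus [simp]: "left_end (g + h) \<longleftrightarrow> left_end g \<and> left_end h"
  by (simp add: left_end_def left_opts_plus)

lemma right_end_plus [simp]: "right_end (g + h) \<longleftrightarrow> right_end g \<and> right_end h"
  by (simp add: right_end_def right_opts_plus)

lemma options_zero [simp]: "options 0 = {||}"
  by (simp add: options_def zero_game_def)

lemma options_LL [simp]: "options (LL x) = {|x|}"
  by (simp add: options_def LL_def)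

lemma left_end_zero [simp]: "left_end 0"
  by (simp add: left_end_def zero_game_def)

lemma right_end_zero [simp]: "right_end 0"
  by (simp add: right_end_def zero_game_def)

lemma right_end_LL [simp]: "right_end (LL x)"
  by (simp add: right_end_def LL_def)

lemma right_end_tau [simp]: "\<not> right_end (tau k)"
  by (cases k) (simp_all add: right_end_def star_def)

lemma option_induct [case_names option]:
  assumes "\<And>g. (\<And>x. x |\<in>| options g \<Longrightarrow> P x) \<Longrightarrow> P g"
  shows "P g"
  by (induction g) (rule assms, auto simp: options_def)

lemma option_induct2 [case_names option]:
  assumes step: "\<And>g h. (\<And>x. x |\<in>| options g \<Longrightarrow> P x h) \<Longrightarrow>
    (\<And>y. y |\<in>| options h \<Longrightarrow> P g y) \<Longrightarrow> P g h"
  shows "P g h"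
proof (induction g arbitrary: h rule: option_induct)
  case (option g)
  note first_summand = this
  show ?case
  proof (induction h rule: option_induct)
    case (option h)
    with first_summand show ?case by (rule step)
  qed
qed

lemma left_wins_first_iff:
  "left_wins_first g \<longleftrightarrow> left_end g \<or> (\<exists>x. x |\<in>| left_opts g \<and> \<not> right_wins_first x)"
  by (cases g) (auto simp: left_end_def)

lemma right_wins_first_iff:
  "right_wins_first g \<longleftrightarrow> right_end g \<or> (\<exists>x. x |\<in>| right_opts g \<and> \<not> left_wins_first x)"
  by (cases g) (auto simp: right_end_def)

section \<open>The parity of the length of a play\<close>

text \<open>The players need not take turns in a play. The name of \<open>even_length\<close> is justified only on
  \<open>uniform_parity\<close> games, where all plays have the same parity.\<close>

function even_length :: "game \<Rightarrow> bool" where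
  "even_length (Game A B) \<longleftrightarrow> fBall (A |\<union>| B) (\<lambda>x. \<not> even_length x)"
  by pat_completeness auto
termination
  by (relation "measure size") (auto simp del: game.size dest: size_left_opt size_right_opt)

inductive uniform_parity :: "game \<Rightarrow> bool" where
  "uniform_parity g"
    if "\<And>x. x |\<in>| options g \<Longrightarrow> uniform_parity x"
      and "\<And>x. x |\<in>| options g \<Longrightarrow> even_length x \<longleftrightarrow> \<not> even_length g"

lemma even_length_iff: "even_length g \<longleftrightarrow> (\<forall>x. x |\<in>| options g \<longrightarrow> \<not> even_length x)"
  by (cases g) (auto simp: options_def)

lemma even_length_if_optionless: "options g = {||} \<Longrightarrow> even_length g"
  by (subst even_length_iff) simp

lemma even_length_zero [simp]: "even_length 0"
  by (simp add: even_length_if_optionless)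

lemma even_length_LL [simp]: "even_length (LL x) \<longleftrightarrow> \<not> even_length x"
  by (subst even_length_iff) simp

lemma uniform_parity_option: "uniform_parity g \<Longrightarrow> x |\<in>| options g \<Longrightarrow> uniform_parity x"
  by (auto elim: uniform_parity.cases)

lemma even_length_option:
  "uniform_parity g \<Longrightarrow> x |\<in>| options g \<Longrightarrow> even_length x \<longleftrightarrow> \<not> even_length g"
  by (auto elim: uniform_parity.cases)

lemma
  assumes "uniform_parity g" "uniform_parity h"
  shows uniform_parity_plus: "uniform_parity (g + h)"
    and even_length_plus: "even_length (g + h) \<longleftrightarrow> (even_length g \<longleftrightarrow> even_length h)"
proof -
  from assms have "uniform_parity (g + h) \<and>
    (even_length (g + h) \<longleftrightarrow> (even_length g \<longleftrightarrow> even_length h))"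
  proof (induction g h rule: option_induct2)
    case (option g h)
    have left_summand: "uniform_parity (x + h) \<and>
        (even_length (x + h) \<longleftrightarrow> \<not> (even_length g \<longleftrightarrow> even_length h))"
      if "x |\<in>| options g" for x
      using option.IH(1) option.prems uniform_parity_option even_length_option that by blast
    have right_summand: "uniform_parity (g + y) \<and>
        (even_length (g + y) \<longleftrightarrow> \<not> (even_length g \<longleftrightarrow> even_length h))"
      if "y |\<in>| options h" for y
      using option.IH(2) option.prems uniform_parity_option even_length_option that by blast
    have flips: "uniform_parity z" "even_length z \<longleftrightarrow> \<not> (even_length g \<longleftrightarrow> even_length h)"
      if "z |\<in>| options (g + h)" for z
      using that left_summand right_summand by (auto simp: options_plus)
    have parity: "even_length (g + h) \<longleftrightarrow> (even_length g \<longleftrightarrow> even_length h)"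
    proof (cases "options (g + h) = {||}")
      case True
      then have "options g = {||}" "options h = {||}" by (auto simp: options_plus)
      with True show ?thesis by (simp add: even_length_if_optionless)
    next
      case False
      with flips(2) show ?thesis by (subst even_length_iff) blast
    qed
    have "uniform_parity (g + h)"
      using flips parity by (intro uniform_parity.intros[of "g + h"]) simp_all
    with parity show ?case by blast
  qed
  then show "uniform_parity (g + h)"
    and "even_length (g + h) \<longleftrightarrow> (even_length g \<longleftrightarrow> even_length h)"
    by simp_all
qed

lemma uniform_parity_zero: "uniform_parity 0"
  by (rule uniform_parity.intros) simp_all

lemma uniform_parity_LL: "uniform_parity x \<Longrightarrow> uniform_parity (LL x)"
  by (auto intro: uniform_parity.intros)

section \<open>Positions in which Left can keep Right able to move\<close>

text \<open>Only even positions matter for the outcome; right ends are included to make the property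
  additive, the sum of two odd right ends being even.\<close>

inductive steerable :: "game \<Rightarrow> bool" where
  "steerable g"
    if "\<And>x. x |\<in>| options g \<Longrightarrow> steerable x"
      and "left_end g \<Longrightarrow> right_end g"
      and "\<not> left_end g \<Longrightarrow> even_length g \<or> right_end g \<Longrightarrow>
        \<exists>x. x |\<in>| left_opts g \<and> \<not> right_end x"

lemma steerable_option: "steerable g \<Longrightarrow> x |\<in>| options g \<Longrightarrow> steerable x"
  by (auto elim: steerable.cases)

lemma steerable_left_end: "steerable g \<Longrightarrow> left_end g \<Longrightarrow> right_end g"
  by (auto elim: steerable.cases)

lemma steerable_left_end_even_length: "steerable g \<Longrightarrow> left_end g \<Longrightarrow> even_length g"
  using steerable_left_end[of g] even_length_if_optionless[of g]
  by (simp add: options_def left_end_def right_end_def)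

lemma steerable_move:
  assumes "steerable g" "\<not> left_end g" "even_length g \<or> right_end g"
  obtains x where "x |\<in>| left_opts g" "\<not> right_end x"
  using assms by (auto elim: steerable.cases)

lemma steerable_move_plus:
  assumes "uniform_parity g" "uniform_parity h" "steerable g" "steerable h"
    and "\<not> left_end g" and even_or_end: "even_length (g + h) \<or> right_end (g + h)"
  shows "\<exists>z. z |\<in>| left_opts (g + h) \<and> \<not> right_end z"
proof -
  have parity: "even_length g \<longleftrightarrow> even_length h" if "\<not> right_end (g + h)"
    using that even_or_end even_length_plus[OF assms(1,2)] by blast
  consider "\<not> right_end h" | "right_end h" "\<not> right_end g" "\<not> left_end h"
    | "right_end h" "even_length g \<or> right_end g"
    using parity steerable_left_end_even_length[OF \<open>steerable h\<close>] by auto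
  then show ?thesis
  proof cases
    case 1
    from \<open>\<not> left_end g\<close> obtain x where "x |\<in>| left_opts g" by (auto simp: left_end_def)
    with 1 show ?thesis by (intro exI[of _ "x + h"]) (simp add: left_opts_plus)
  next
    case 2
    then obtain y where "y |\<in>| left_opts h" by (auto simp: left_end_def)
    with 2 show ?thesis by (intro exI[of _ "g + y"]) (simp add: left_opts_plus)
  next
    case 3
    then obtain x where "x |\<in>| left_opts g" "\<not> right_end x"
      using steerable_move[OF \<open>steerable g\<close> \<open>\<not> left_end g\<close>] by blast
    then show ?thesis by (intro exI[of _ "x + h"]) (simp add: left_opts_plus)
  qed
qed

lemma steerable_plus:
  assumes "uniform_parity g" "uniform_parity h" "steerable g" "steerable h"
  shows "steerable (g + h)"
  using assms
proof (induction g h rule: option_induct2)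
  case (option g h)
  show ?case
  proof (rule steerable.intros)
    show "steerable z" if "z |\<in>| options (g + h)" for z
      using that option.prems
      by (auto simp: options_plus intro: option.IH uniform_parity_option steerable_option)
    show "right_end (g + h)" if "left_end (g + h)"
      using that option.prems by (simp add: steerable_left_end)
    show "\<exists>z. z |\<in>| left_opts (g + h) \<and> \<not> right_end z"
      if "\<not> left_end (g + h)" "even_length (g + h) \<or> right_end (g + h)"
      using that option.prems steerable_move_plus[of g h] steerable_move_plus[of h g]
      by (auto simp: add.commute[of h g])
  qed
qed

lemma steerable_zero: "steerable 0"
  by (rule steerable.intros) simp_all

lemma steerable_LL: "steerable x \<Longrightarrow> \<not> right_end x \<Longrightarrow> steerable (LL x)"
  by (rule steerable.intros) (auto simp: LL_def options_def left_end_def)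

section \<open>Parity-determined games\<close>

definition parity_determined :: "game set" where
  "parity_determined = {g. uniform_parity g \<and> steerable g}"

lemma parity_determined_option:
  "g \<in> parity_determined \<Longrightarrow> x |\<in>| options g \<Longrightarrow> x \<in> parity_determined"
  by (auto simp: parity_determined_def intro: uniform_parity_option steerable_option)

lemma closed_parity_determined: "closed_games parity_determined"
  unfolding closed_games_def
proof (intro conjI ballI)
  show "g + h \<in> parity_determined" if "g \<in> parity_determined" "h \<in> parity_determined" for g h
    using that by (simp add: parity_determined_def uniform_parity_plus steerable_plus)
  show "fset (left_opts g) \<subseteq> parity_determined" "fset (right_opts g) \<subseteq> parity_determined"
    if "g \<in> parity_determined" for g
    using parity_determined_option[OF that] by (auto simp: options_def)
qed

lemma parity_determined_wins_first:
  assumes "g \<in> parity_determined"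
  shows "(left_wins_first g \<longleftrightarrow> even_length g) \<and>
    (right_wins_first g \<longleftrightarrow> even_length g \<or> right_end g)"
  using assms
proof (induction g rule: option_induct)
  case (option g)
  then have uniform_parity: "uniform_parity g" and steerable: "steerable g"
    by (simp_all add: parity_determined_def)
  have flips: "even_length x \<longleftrightarrow> \<not> even_length g"
    if "x |\<in>| left_opts g \<or> x |\<in>| right_opts g" for x
    using even_length_option[OF uniform_parity] that by (auto simp: options_def)
  have right_reply: "right_wins_first x \<longleftrightarrow> \<not> even_length g \<or> right_end x"
    if "x |\<in>| left_opts g" for x
    using option parity_determined_option flips that by (auto simp: options_def)
  have left_reply: "left_wins_first x \<longleftrightarrow> \<not> even_length g" if "x |\<in>| right_opts g" for x
    using option parity_determined_option flips that by (auto simp: options_def)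
  have "left_wins_first g \<longleftrightarrow> even_length g"
  proof (cases "left_end g")
    case True
    then show ?thesis
      using steerable_left_end_even_length[OF steerable] by (simp add: left_wins_first_iff)
  next
    case False
    with right_reply steerable_move[OF steerable] show ?thesis
      unfolding left_wins_first_iff[of g] by metis
  qed
  moreover have "right_wins_first g \<longleftrightarrow> even_length g \<or> right_end g"
    using left_reply by (auto simp: right_wins_first_iff[of g] right_end_def)
  ultimately show ?case by blast
qed

lemma parity_determined_misere_outcome:
  assumes "g \<in> parity_determined"
  shows "misere_outcome g =
    (if even_length g then Outcome_N else if right_end g then Outcome_R else Outcome_P)"
  using parity_determined_wins_first[OF assms] by (simp add: misere_outcome_def)

lemma parity_determined_equiv_mod_iff:
  assumes "closed_games \<Gamma>" "\<Gamma> \<subseteq> parity_determined"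
    and "\<xi> \<in> \<Gamma>" "\<not> even_length \<xi>" "right_end \<xi>"
    and "g \<in> \<Gamma>" "h \<in> \<Gamma>"
  shows "equiv_mod \<Gamma> g h \<longleftrightarrow>
    (even_length g \<longleftrightarrow> even_length h) \<and> (right_end g \<longleftrightarrow> right_end h)"
proof -
  have outcome: "misere_outcome (a + b) =
      (if even_length a \<longleftrightarrow> even_length b then Outcome_N
       else if right_end a \<and> right_end b then Outcome_R else Outcome_P)"
    if "a \<in> \<Gamma>" "b \<in> \<Gamma>" for a b
  proof -
    have "uniform_parity a" "uniform_parity b" "a + b \<in> parity_determined"
      using that assms(1,2) by (auto simp: parity_determined_def closed_games_def)
    then show ?thesis by (simp add: parity_determined_misere_outcome even_length_plus)
  qed
  have "0 \<in> \<Gamma>" using zero_in_closed assms(1,3) by blast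
  have "(even_length g \<longleftrightarrow> even_length h) \<and> (right_end g \<longleftrightarrow> right_end h)"
    if "equiv_mod \<Gamma> g h"
  proof -
    from that have "misere_outcome (g + 0) = misere_outcome (h + 0)"
      and "misere_outcome (g + \<xi>) = misere_outcome (h + \<xi>)"
      using \<open>0 \<in> \<Gamma>\<close> \<open>\<xi> \<in> \<Gamma>\<close> unfolding equiv_mod_def by blast+
    then show ?thesis
      using assms(3-7) \<open>0 \<in> \<Gamma>\<close>
      by (simp add: outcome del: add_0_right split: if_splits)
  qed
  moreover have "equiv_mod \<Gamma> g h"
    if "even_length g \<longleftrightarrow> even_length h" "right_end g \<longleftrightarrow> right_end h"
    using that assms(6,7) by (simp add: equiv_mod_def outcome)
  ultimately show ?thesis by blast
qed

lemma parity_determined_misere_monoid: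
  assumes "closed_games \<Gamma>" "\<Gamma> \<subseteq> parity_determined" "star \<in> \<Gamma>"
    and "\<xi> \<in> \<Gamma>" "\<not> even_length \<xi>" "right_end \<xi>"
  shows "carrier (misere_monoid \<Gamma>) =
      {misere_class \<Gamma> 0, misere_class \<Gamma> star, misere_class \<Gamma> (star + star), misere_class \<Gamma> \<xi>}"
    and "card (carrier (misere_monoid \<Gamma>)) = 4"
proof -
  let ?classes = "{misere_class \<Gamma> 0, misere_class \<Gamma> star, misere_class \<Gamma> (star + star),
    misere_class \<Gamma> \<xi>}"
  have members: "0 \<in> \<Gamma>" "star \<in> \<Gamma>" "star + star \<in> \<Gamma>" "\<xi> \<in> \<Gamma>"
    using assms zero_in_closed by (auto simp: closed_games_def)
  have "uniform_parity star" using assms(2,3) by (auto simp: parity_determined_def)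
  moreover have star: "\<not> even_length star" "\<not> right_end star"
    by (simp_all add: star_def right_end_def)
  ultimately have star_plus_star: "even_length (star + star)" "\<not> right_end (star + star)"
    by (simp_all add: even_length_plus)
  have class_eq_iff: "misere_class \<Gamma> g = misere_class \<Gamma> h \<longleftrightarrow>
      (even_length g \<longleftrightarrow> even_length h) \<and> (right_end g \<longleftrightarrow> right_end h)"
    if "g \<in> \<Gamma>" "h \<in> \<Gamma>" for g h
    using parity_determined_equiv_mod_iff[OF assms(1,2,4-6) that] misere_class_eq_iff[OF that] by simp
  have "misere_class \<Gamma> g \<in> ?classes" if "g \<in> \<Gamma>" for g
    using that members star star_plus_star assms(5,6)
    by (cases "even_length g"; cases "right_end g") (simp_all add: class_eq_iff)
  then show carrier: "carrier (misere_monoid \<Gamma>) = ?classes"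
    using members by (auto simp: misere_monoid_def)
  show "card (carrier (misere_monoid \<Gamma>)) = 4"
    using members star star_plus_star assms(5,6) by (simp add: carrier class_eq_iff)
qed

section \<open>The games \<open>tau k\<close>\<close>

lemma even_length_tau [simp]: "even_length (tau k) \<longleftrightarrow> odd k"
  by (induction k) (simp_all add: star_def)

lemma parity_determined_symmetric:
  assumes "x \<in> parity_determined" "even_length x \<or> \<not> right_end x"
  shows "Game {|x|} {|x|} \<in> parity_determined"
  using assms unfolding parity_determined_def
  by (auto simp: options_def left_end_def right_end_def
      intro!: uniform_parity.intros[of "Game {|x|} {|x|}"] steerable.intros[of "Game {|x|} {|x|}"])

lemma tau_in_parity_determined: "tau k \<in> parity_determined"
proof (induction k)
  case 0
  have "0 \<in> parity_determined"
    by (simp add: parity_determined_def uniform_parity_zero steerable_zero)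
  then show ?case by (simp add: star_def parity_determined_symmetric)
next
  case (Suc k)
  then show ?case by (simp add: parity_determined_symmetric)
qed

lemma star_in_closed:
  assumes "closed_games \<Gamma>" "tau k \<in> \<Gamma>"
  shows "star \<in> \<Gamma>"
  using assms(2)
proof (induction k)
  case (Suc k)
  then have "fset (left_opts (tau (Suc k))) \<subseteq> \<Gamma>"
    using assms(1) unfolding closed_games_def by blast
  with Suc.IH show ?case by simp
qed simp

lemma star_in_cl_LL_tau: "star \<in> cl (LL (tau k))"
proof -
  have "fset (left_opts (LL (tau k))) \<subseteq> cl (LL (tau k))"
    using closed_games_cl cl_self unfolding closed_games_def by blast
  then have "tau k \<in> cl (LL (tau k))" by (simp add: LL_def)
  with closed_games_cl show ?thesis by (rule star_in_closed)
qed

theorem theorem3p4p6: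
  fixes n :: nat
  shows "let \<Gamma> = cl (LL (tau (2 * n + 1))) in
           carrier (misere_monoid \<Gamma>) =
             {misere_class \<Gamma> 0, misere_class \<Gamma> star, misere_class \<Gamma> (star + star),
              misere_class \<Gamma> (LL (tau (2 * n + 1)))}
           \<and> card (carrier (misere_monoid \<Gamma>)) = 4"
proof -
  let ?\<xi> = "LL (tau (2 * n + 1))"
  have "?\<xi> \<in> parity_determined"
    using tau_in_parity_determined[of "2 * n + 1"] right_end_tau
    unfolding parity_determined_def by (blast intro: uniform_parity_LL steerable_LL)
  then have "cl ?\<xi> \<subseteq> parity_determined"
    using closed_parity_determined by (rule cl_least)
  moreover have "\<not> even_length ?\<xi>"
    unfolding even_length_LL even_length_tau by simp
  ultimately show ?thesis
    unfolding Let_def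
    using parity_determined_misere_monoid[OF closed_games_cl _ star_in_cl_LL_tau cl_self]
      right_end_LL by blast
qed

end
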